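(* Let $n\geq 1$ and $\Pi\subseteq\mathfrak{S}_{n}$. Then $$F(\Pi;y,t)=(1+yt)(1+yt^{2})^{n-1}\,P^{(\mathrm{lpk},\mathrm{val},\mathrm{des})}\left(\Pi^{rc};\frac{t(1+y)(y+t)}{(y+t^{2})(1+yt)},\frac{t(1+y)(1+yt)}{(1+yt^{2})(y+t)},\frac{y+t^{2}}{1+yt^{2}}\right).$$
   Context: $\mathfrak{S}_n$ is the set of permutations $\pi=\pi_1\cdots\pi_n$ of $[n]=\{1,\dots,n\}$. For $\pi\in\mathfrak{S}_n$: $\mathrm{des}(\pi)$ is the number of $i\in[n-1]$ with $\pi_i>\pi_{i+1}$; $\mathrm{lpk}(\pi)$ is the number of left peaks, where $i\in[n-1]$ is a left peak if either $2\le i\le n-1$ and $\pi_{i-1}<\pi_i>\pi_{i+1}$, or $i=1$ and $\pi_1>\pi_2$; $\mathrm{val}(\pi)$ is the number of valleys, i.e. of $i$ with $2\le i\le n-1$ and $\pi_{i-1}>\pi_i<\pi_{i+1}$. The reverse complement of $\pi$ is $\pi^{rc}=(n+1-\pi_n)(n+1-\pi_{n-1})\cdots(n+1-\pi_1)$, and $\Pi^{rc}=\{\pi^{rc}\mid\pi\in\Pi\}$ for $\Pi\subseteq\mathfrak{S}_n$. $\mathfrak{B}_n$ is the set of signed permutations: permutations $\sigma$ of $\{-n,\dots,-1,0,1,\dots,n\}$ with $\sigma_{-i}=-\sigma_i$ for all $i$ (so $\sigma_0=0$), written $\sigma=\sigma_1\cdots\sigma_n$. For $\sigma\in\mathfrak{B}_n$: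 $\mathrm{des}_B(\sigma)$ is the number of $i\in\{0,1,\dots,n-1\}$ with $\sigma_i>\sigma_{i+1}$ (where $\sigma_0=0$); the flag descent number $\mathrm{fdes}(\sigma)$ is $2\,\mathrm{des}_B(\sigma)$ if $\sigma_1>0$ and $2\,\mathrm{des}_B(\sigma)-1$ if $\sigma_1<0$; $\mathrm{neg}(\sigma)$ is the number of $i\in[n]$ with $\sigma_i<0$. For $\pi\in\mathfrak{S}_n$, $\mathfrak{B}(\pi)\subseteq\mathfrak{B}_n$ is the set of the $2^n$ signed permutations obtained by choosing any subset of the letters of $\pi$ and replacing them with their negatives; for $\Pi\subseteq\mathfrak{S}_n$, $\mathfrak{B}(\Pi)=\bigcup_{\pi\in\Pi}\mathfrak{B}(\pi)$. Define $F(\Pi;y,t)=\sum_{\sigma\in\mathfrak{B}(\Pi)}y^{\mathrm{neg}(\sigma)}t^{\mathrm{fdes}(\sigma)}$ and $P^{(\mathrm{lpk},\mathrm{val},\mathrm{des})}(\Pi;y,z,t)=\sum_{\pi\in\Pi}y^{\mathrm{lpk}(\pi)}z^{\mathrm{val}(\pi)}t^{\mathrm{des}(\pi)}$. The identity is one of rational functions in the indeterminates $y,t$. *)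

theory Defs
  imports
    "HOL-Combinatorics.Permutations"
    "HOL-Computational_Algebra.Computational_Algebra"
begin

text \<open>
  A permutation of \<open>{1..n}\<close> is a function on \<^typ>\<open>nat\<close> that permutes \<open>{1..n}\<close>
  and is the identity elsewhere; the one-line notation is \<open>p 1, ..., p n\<close>.
\<close>

definition perms :: "nat \<Rightarrow> (nat \<Rightarrow> nat) set" where
  "perms n = {p. p permutes {1..n}}"

definition des :: "nat \<Rightarrow> (nat \<Rightarrow> nat) \<Rightarrow> nat" where
  "des n p = card {i \<in> {1..n-1}. p i > p (i + 1)}"

definition lpk :: "nat \<Rightarrow> (nat \<Rightarrow> nat) \<Rightarrow> nat" where
  "lpk n p = card {i \<in> {1..n-1}.
     (2 \<le> i \<and> p (i - 1) < p i \<and> p i > p (i + 1)) \<or> (i = 1 \<and> p 1 > p 2)}"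

definition val :: "nat \<Rightarrow> (nat \<Rightarrow> nat) \<Rightarrow> nat" where
  "val n p = card {i \<in> {2..n-1}. p (i - 1) > p i \<and> p i < p (i + 1)}"

definition rev_compl :: "nat \<Rightarrow> (nat \<Rightarrow> nat) \<Rightarrow> (nat \<Rightarrow> nat)" where
  "rev_compl n p = (\<lambda>i. if i \<in> {1..n} then n + 1 - p (n + 1 - i) else i)"

text \<open>
  Likewise, a signed permutation is a function on \<^typ>\<open>int\<close> that is the identity
  outside \<open>{-n..n}\<close>.
\<close>

definition signed_perms :: "nat \<Rightarrow> (int \<Rightarrow> int) set" where
  "signed_perms n = {s. s permutes {- int n..int n} \<and> (\<forall>i. s (- i) = - s i)}"

definition desB :: "nat \<Rightarrow> (int \<Rightarrow> int) \<Rightarrow> nat" where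
  "desB n s = card {i \<in> {0..int n - 1}. s i > s (i + 1)}"

text \<open>
  The truncated subtraction is harmless: if \<open>s 1 < 0 = s 0\<close> and \<open>n \<ge> 1\<close>, then
  \<open>0\<close> is a descent, so \<open>desB n s \<ge> 1\<close>.
\<close>

definition fdes :: "nat \<Rightarrow> (int \<Rightarrow> int) \<Rightarrow> nat" where
  "fdes n s = (if s 1 > 0 then 2 * desB n s else 2 * desB n s - 1)"

definition neg :: "nat \<Rightarrow> (int \<Rightarrow> int) \<Rightarrow> nat" where
  "neg n s = card {i \<in> {1..int n}. s i < 0}"

text \<open>\<open>L\<close> is the set of letters of \<open>p\<close> that are replaced with their negatives.\<close>

definition signings :: "nat \<Rightarrow> (nat \<Rightarrow> nat) \<Rightarrow> (int \<Rightarrow> int) set" where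
  "signings n p = {s \<in> signed_perms n. \<exists>L \<subseteq> {1..n}. \<forall>i \<in> {1..n}.
     s (int i) = (if p i \<in> L then - int (p i) else int (p i))}"

definition signings_set :: "nat \<Rightarrow> (nat \<Rightarrow> nat) set \<Rightarrow> (int \<Rightarrow> int) set" where
  "signings_set n P = (\<Union>p \<in> P. signings n p)"

definition neg_fdes_gf :: "nat \<Rightarrow> (nat \<Rightarrow> nat) set \<Rightarrow> 'a \<Rightarrow> 'a \<Rightarrow> 'a::comm_semiring_1" where
  "neg_fdes_gf n P y t = (\<Sum>s \<in> signings_set n P. y ^ neg n s * t ^ fdes n s)"

definition lpk_val_des_gf ::
  "nat \<Rightarrow> (nat \<Rightarrow> nat) set \<Rightarrow> 'a \<Rightarrow> 'a \<Rightarrow> 'a \<Rightarrow> 'a::comm_semiring_1" where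
  "lpk_val_des_gf n P y z t = (\<Sum>p \<in> P. y ^ lpk n p * z ^ val n p * t ^ des n p)"

text \<open>
  The field of rational functions in the indeterminates \<open>y\<close>, \<open>t\<close> over the rationals is
  realised as the fraction field of \<open>\<rat>[y][t]\<close>: \<open>y\<close> is the inner variable (a constant
  as a polynomial in \<open>t\<close>) and \<open>t\<close> is the outer variable.
\<close>

type_synonym ratfun2 = "rat poly poly fract"

definition var_y :: ratfun2 where
  "var_y = to_fract [:[:0, 1:]:]"

definition var_t :: ratfun2 where
  "var_t = to_fract [:0, 1:]"

end

theory Submission
  imports Defs
begin

text \<open>
  Whether a signed word descends at a position \<open>i \<ge> 1\<close> depends only on the sign of the larger
  of the two letters in absolute value: at a descent of \<open>p\<close> it does so iff \<open>p i\<close> is positive, at an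
  ascent iff \<open>p (i + 1)\<close> is negative. Hence the sum over all signings of \<open>p\<close> factors into a product
  over the positions, whose factor at \<open>i\<close> depends only on whether \<open>p\<close> descends at \<open>i - 1\<close> and
  at \<open>i\<close>. The three arguments on the right-hand side reproduce these factors up to a
  coboundary, which telescopes. Under reverse complement, peaks become valleys, and valleys
  (including a final descent) become left peaks.
\<close>

text \<open>Unlike \<open>L\<close> in \<open>signings\<close>, \<open>S\<close> is a set of positions, not of letters.\<close>

definition signing :: "(nat \<Rightarrow> nat) \<Rightarrow> nat set \<Rightarrow> int \<Rightarrow> int" where
  "signing p S j = (if nat \<bar>j\<bar> \<in> S then -1 else 1) * sgn j * int (p (nat \<bar>j\<bar>))"

text \<open>The bounds make \<open>descent n p 0\<close> and \<open>descent n p n\<close> false, so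
  the last letter counts as followed by an ascent.\<close>

definition descent :: "nat \<Rightarrow> (nat \<Rightarrow> nat) \<Rightarrow> nat \<Rightarrow> bool" where
  "descent n p i \<longleftrightarrow> 1 \<le> i \<and> i < n \<and> p i > p (i + 1)"

lemma power_card_filter:
  fixes x :: "'a::comm_monoid_mult"
  assumes "finite A"
  shows "x ^ card {i \<in> A. Q i} = (\<Prod>i\<in>A. if Q i then x else 1)"
  using assms by (simp flip: prod.inter_filter)

lemma prod_add_Pow:
  fixes f g :: "'b \<Rightarrow> 'a::comm_semiring_1"
  assumes "finite A"
  shows "(\<Prod>i\<in>A. f i + g i) = (\<Sum>S\<in>Pow A. \<Prod>i\<in>A. if i \<in> S then f i else g i)"
  unfolding prod_add[OF assms]
  using assms by (auto intro!: sum.cong simp: prod.If_cases Int_absorb1 Int_absorb2 Diff_eq)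

section \<open>Signings parametrised by sets of negated positions\<close>

lemma perms_less_iff_not_descent:
  assumes "p \<in> perms n" "1 \<le> i" "i < n"
  shows "p i < p (i + 1) \<longleftrightarrow> \<not> descent n p i"
proof -
  have "inj p" using assms(1) by (auto simp: perms_def permutes_inj)
  then have "p i \<noteq> p (i + 1)" by (simp add: inj_eq)
  then show ?thesis using assms by (auto simp: descent_def)
qed

lemma signing_minus: "signing p S (- j) = - signing p S j"
  by (simp add: signing_def sgn_minus)

lemma signing_of_nat:
  "signing p S (int i) = (if i = 0 then 0 else if i \<in> S then - int (p i) else int (p i))"
  by (simp add: signing_def)

lemma perms_eq_0_iff:
  assumes "p \<in> perms n" shows "p i = 0 \<longleftrightarrow> i = 0"
proof -
  have p: "p permutes {1..n}" using assms by (simp add: perms_def)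
  then have "p 0 = 0" by (simp add: permutes_not_in)
  then show ?thesis using permutes_inj[OF p] by (metis injD)
qed

lemma perms_in_interval:
  assumes "p \<in> perms n" shows "p i \<in> {1..n} \<longleftrightarrow> i \<in> {1..n}"
  using assms by (simp only: perms_def mem_Collect_eq permutes_in_image)

lemma signing_in_signed_perms:
  assumes p: "p \<in> perms n" and S: "S \<subseteq> {1..n}"
  shows "signing p S \<in> signed_perms n"
proof -
  have pp: "p permutes {1..n}" using p by (simp add: perms_def)
  have abs: "\<bar>signing p S j\<bar> = int (p (nat \<bar>j\<bar>))" for j
    using perms_eq_0_iff[OF p] by (cases "j = 0") (simp_all add: signing_def abs_mult)
  have "inj (signing p S)"
  proof (rule injI)
    fix j k assume eq: "signing p S j = signing p S k"
    then have "p (nat \<bar>j\<bar>) = p (nat \<bar>k\<bar>)" using abs by (metis of_nat_eq_iff)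
    then have "nat \<bar>j\<bar> = nat \<bar>k\<bar>" using permutes_inj[OF pp] by (simp add: inj_eq)
    then consider "j = k" | "j = - k" by linarith
    then show "j = k"
    proof cases
      case 2
      then have "signing p S k = 0" using eq by (simp add: signing_minus)
      then have "p (nat \<bar>k\<bar>) = 0" using abs[of k] by simp
      then show ?thesis using perms_eq_0_iff[OF p] 2 by simp
    qed
  qed
  moreover have "signing p S ` {- int n..int n} \<subseteq> {- int n..int n}"
  proof safe
    fix j assume j: "j \<in> {- int n..int n}"
    then have "p (nat \<bar>j\<bar>) \<le> n"
      using perms_in_interval[OF p, of "nat \<bar>j\<bar>"] perms_eq_0_iff[OF p, of "nat \<bar>j\<bar>"]
      by (cases "j = 0") auto
    then have "\<bar>signing p S j\<bar> \<le> int n" using abs by simp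
    then show "signing p S j \<in> {- int n..int n}" by (simp add: abs_le_iff)
  qed
  ultimately have "bij_betw (signing p S) {- int n..int n} {- int n..int n}"
    unfolding bij_betw_def
    by (meson endo_inj_surj finite_atLeastAtMost_int inj_on_subset subset_UNIV)
  moreover have "signing p S j = j" if "j \<notin> {- int n..int n}" for j
  proof -
    \<comment> \<open>Since \<open>S\<close> lies in \<open>{1..n}\<close>, no sign changes out
      here, and \<open>sgn j * \<bar>j\<bar> = j\<close>.\<close>
    have "nat \<bar>j\<bar> \<notin> {1..n}" using that by auto
    moreover from this have "p (nat \<bar>j\<bar>) = nat \<bar>j\<bar>" using pp by (simp add: permutes_not_in)
    ultimately show ?thesis using S by (auto simp: signing_def mult_sgn_abs sgn_mult_abs)
  qed
  ultimately have "signing p S permutes {- int n..int n}"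
    by (rule bij_imp_permutes)
  then show ?thesis by (simp add: signed_perms_def signing_minus)
qed

text \<open>Letter sets \<open>L\<close> and position sets \<open>S\<close> correspond through
  \<open>p\<close>, and \<open>S\<close> can be read off a signing as its positions with negative
  value.\<close>

lemma bij_betw_signing:
  assumes p: "p \<in> perms n"
  shows "bij_betw (signing p) (Pow {1..n}) (signings n p)"
proof (rule bij_betw_imageI[OF inj_onI subset_antisym[OF subsetI subsetI]])
  fix S S' assume SS: "S \<in> Pow {1..n}" "S' \<in> Pow {1..n}" and eq: "signing p S = signing p S'"
  have rec: "X = {i \<in> {1..n}. signing p X (int i) < 0}" if "X \<in> Pow {1..n}" for X
    using that perms_eq_0_iff[OF p]
    by (auto simp: signing_of_nat simp flip: neq0_conv split: if_splits)
  show "S = S'" using rec[OF SS(1)] rec[OF SS(2)] eq by simp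
next
  fix s assume "s \<in> signing p ` Pow {1..n}"
  then obtain S where S: "S \<subseteq> {1..n}" and s: "s = signing p S" by auto
  have "inj p" using p by (auto simp: perms_def permutes_inj)
  then have "\<forall>i\<in>{1..n}. s (int i) = (if p i \<in> p ` S then - int (p i) else int (p i))"
    by (auto simp: s signing_of_nat inj_image_mem_iff)
  moreover have "p ` S \<subseteq> {1..n}" using S perms_in_interval[OF p] by blast
  ultimately show "s \<in> signings n p"
    using signing_in_signed_perms[OF p S] by (auto simp: signings_def s)
next
  fix s assume "s \<in> signings n p"
  then obtain L where s: "s permutes {- int n..int n}" and odd: "\<And>j. s (- j) = - s j"
    and L: "\<And>i. i \<in> {1..n} \<Longrightarrow> s (int i) = (if p i \<in> L then - int (p i) else int (p i))"
    by (auto simp: signings_def signed_perms_def)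
  let ?S = "{i \<in> {1..n}. p i \<in> L}"
  have t: "signing p ?S permutes {- int n..int n}"
    using signing_in_signed_perms[OF p, of ?S] unfolding signed_perms_def by blast
  \<comment> \<open>Both maps are odd, so agreement on the naturals is enough.\<close>
  have nat: "s (int i) = signing p ?S (int i)" for i
  proof (cases "i \<in> {1..n}")
    case True
    then show ?thesis by (auto simp: L signing_of_nat)
  next
    case False
    then consider "i = 0" | "int i \<notin> {- int n..int n}" by force
    then show ?thesis
    proof cases
      case 1
      then show ?thesis using odd[of 0] by (simp add: signing_def)
    next
      case 2
      then show ?thesis using s t by (metis permutes_not_in)
    qed
  qed
  have "s j = signing p ?S j" for j
  proof (cases "j \<ge> 0")
    case True
    then show ?thesis using nat[of "nat j"] by simp
  next
    case False
    then show ?thesis using nat[of "nat (- j)"] odd[of j] by (simp add: signing_minus)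
  qed
  then show "s \<in> signing p ` Pow {1..n}" by blast
qed

section \<open>Negations and flag descents of a signing\<close>

lemma neg_signing:
  assumes p: "p \<in> perms n" and S: "S \<subseteq> {1..n}"
  shows "neg n (signing p S) = card S"
proof -
  have "{i \<in> {1..int n}. signing p S i < 0} = int ` S"
  proof (intro subset_antisym subsetI)
    fix j assume j: "j \<in> {i \<in> {1..int n}. signing p S i < 0}"
    then have "j = int (nat j)" by simp
    moreover have "nat j \<in> S"
      using j signing_of_nat[of p S "nat j"] by (auto split: if_splits)
    ultimately show "j \<in> int ` S" by blast
  next
    fix j assume "j \<in> int ` S"
    then obtain i where "i \<in> S" "j = int i" by auto
    then show "j \<in> {i \<in> {1..int n}. signing p S i < 0}"
      using S perms_eq_0_iff[OF p, of i] by (auto simp: signing_of_nat)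
  qed
  then show ?thesis by (simp add: neg_def card_image)
qed

text \<open>Position 0 descends iff letter 1 is negated; the correction in \<open>fdes\<close> then
  cuts its contribution from 2 to 1. At \<open>i \<ge> 1\<close> the letter of larger absolute value
  decides: letter \<open>i\<close> if \<open>p\<close> descends there, otherwise letter
  \<open>i + 1\<close>.\<close>

lemma fdes_signing:
  assumes p: "p \<in> perms n" and n: "n \<ge> 1"
  shows "fdes n (signing p S) =
    (if 1 \<in> S then 1 else 0) +
    2 * card {i \<in> {1..<n}. if descent n p i then i \<notin> S else Suc i \<in> S}"
proof -
  let ?s = "signing p S"
  let ?A = "{i \<in> {1..<n}. if descent n p i then i \<notin> S else Suc i \<in> S}"
  have p1: "p 1 > 0" using perms_eq_0_iff[OF p, of 1] by simp
  have s1: "?s 1 = (if 1 \<in> S then - int (p 1) else int (p 1))"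
    using signing_of_nat[of p S 1] by simp
  have iff: "?s (int i) > ?s (int i + 1) \<longleftrightarrow> i \<in> ?A" if "i \<in> {1..<n}" for i
  proof -
    have "p i > 0" "p (Suc i) > 0"
      using that perms_eq_0_iff[OF p, of i] perms_eq_0_iff[OF p, of "Suc i"] by simp_all
    moreover have "p i < p (Suc i) \<longleftrightarrow> \<not> descent n p i"
      using perms_less_iff_not_descent[OF p, of i] that by simp
    moreover have "p i > p (Suc i) \<longleftrightarrow> descent n p i"
      using that by (simp add: descent_def)
    moreover have "?s (int i + 1) = (if Suc i \<in> S then - int (p (Suc i)) else int (p (Suc i)))"
      unfolding signing_of_nat[of p S "Suc i", simplified of_nat_Suc add.commute[of 1]] by simp
    ultimately show ?thesis using that by (auto simp: signing_of_nat)
  qed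
  have "{i \<in> {0..int n - 1}. ?s i > ?s (i + 1)} = (if 1 \<in> S then {0} else {}) \<union> int ` ?A"
    (is "?D = ?E")
  proof (rule set_eqI)
    fix j
    consider "j < 0" | "j = 0" | "j > 0" "j < int n" | "j \<ge> int n" "j > 0" by linarith
    then show "j \<in> ?D \<longleftrightarrow> j \<in> ?E"
    proof cases
      case 3
      then obtain i where i: "i \<in> {1..<n}" "j = int i"
        by (intro that[of "nat j"]) auto
      then have "j \<in> ?D \<longleftrightarrow> i \<in> ?A"
        using iff[OF i(1)] by simp
      also have "\<dots> \<longleftrightarrow> j \<in> ?E"
        using i by auto
      finally show ?thesis .
    qed (use n s1 p1 signing_of_nat[of p S 0] in auto)
  qed
  moreover have "card ?E = (if 1 \<in> S then 1 else 0) + card ?A"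
    by (subst card_Un_disjoint) (auto simp: card_image)
  ultimately have "desB n ?s = (if 1 \<in> S then 1 else 0) + card ?A"
    by (simp add: desB_def)
  then show ?thesis using s1 p1 by (simp add: fdes_def)
qed

text \<open>The summand with \<open>y\<close> belongs to negating letter \<open>i\<close>, which
  gives a descent at \<open>i - 1\<close> iff \<open>p\<close> ascends there; the other belongs to
  keeping it, which gives one at \<open>i\<close> iff \<open>p\<close> descends there. Each descent
  weighs \<open>t\<^sup>2\<close>, the one at 0 only \<open>t\<close>.\<close>

lemma signings_gf_eq_prod:
  fixes y t :: "'a::comm_semiring_1"
  assumes p: "p \<in> perms n" and n: "n \<ge> 1"
  shows "(\<Sum>s\<in>signings n p. y ^ neg n s * t ^ fdes n s) =
    (\<Prod>i\<in>{1..n}. y * (if i = 1 then t else if descent n p (i - 1) then 1 else t\<^sup>2)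
                 + (if descent n p i then t\<^sup>2 else 1))"
proof -
  let ?d = "descent n p"
  let ?f = "\<lambda>i. y * (if i = 1 then t else if ?d (i - 1) then 1 else t\<^sup>2)"
  let ?g = "\<lambda>i. if ?d i then t\<^sup>2 else 1"
  have "y ^ neg n (signing p S) * t ^ fdes n (signing p S) =
      (\<Prod>i\<in>{1..n}. if i \<in> S then ?f i else ?g i)" if S: "S \<subseteq> {1..n}" for S
  proof -
    \<comment> \<open>A descent \<open>i\<close> of the signed word is charged to the letter whose sign decides it:
      letter \<open>i\<close> (\<open>?u\<close>) or letter \<open>i + 1\<close> (\<open>?v\<close>).\<close>
    let ?u = "\<lambda>i. if i \<notin> S \<and> ?d i then t\<^sup>2 else 1"
    let ?v = "\<lambda>i. if i \<in> S \<and> \<not> ?d (i - 1) then t\<^sup>2 else 1"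
    let ?v' = "\<lambda>i. if i = 1 then (if i \<in> S then t else 1) else ?v i"
    have "{i \<in> {1..n}. i \<in> S} = S" using S by auto
    then have y: "y ^ neg n (signing p S) = (\<Prod>i\<in>{1..n}. if i \<in> S then y else 1)"
      using power_card_filter[of "{1..n}" y "\<lambda>i. i \<in> S"] by (simp add: neg_signing[OF p S])
    have "t ^ fdes n (signing p S) = (if 1 \<in> S then t else 1) *
        (\<Prod>i\<in>{1..<n}. if (if ?d i then i \<notin> S else Suc i \<in> S) then t\<^sup>2 else 1)"
      unfolding fdes_signing[OF p n] power_add power_mult
      by (simp only: power_card_filter finite_atLeastLessThan) simp
    also have "(\<Prod>i\<in>{1..<n}. if (if ?d i then i \<notin> S else Suc i \<in> S) then t\<^sup>2 else 1)
        = (\<Prod>i\<in>{1..<n}. ?u i) * (\<Prod>i\<in>{1..<n}. ?v (Suc i))"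
      unfolding prod.distrib[symmetric] by (rule prod.cong) auto
    \<comment> \<open>The shift indexes each weight by the letter that decides it; from 2 on,
      \<open>?v'\<close> agrees with \<open>?v\<close>.\<close>
    also have "(\<Prod>i\<in>{1..<n}. ?v (Suc i)) = (\<Prod>i\<in>{2..n}. ?v' i)"
      by (rule prod.reindex_bij_witness[of _ "\<lambda>i. i - 1" Suc]) auto
    \<comment> \<open>The index \<open>n\<close> adds only a factor 1, because
      \<open>descent n p n\<close> is false.\<close>
    also have "(\<Prod>i\<in>{1..<n}. ?u i) = (\<Prod>i\<in>{1..n}. ?u i)"
      by (rule prod.mono_neutral_left) (auto simp: descent_def)
    also have "(if 1 \<in> S then t else 1) * ((\<Prod>i\<in>{1..n}. ?u i) * (\<Prod>i\<in>{2..n}. ?v' i))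
        = (\<Prod>i\<in>{1..n}. ?u i) * (?v' 1 * (\<Prod>i\<in>{2..n}. ?v' i))"
      by (simp add: mult.left_commute)
    also have "?v' 1 * (\<Prod>i\<in>{2..n}. ?v' i) = (\<Prod>i\<in>{1..n}. ?v' i)"
      using prod.atLeast_Suc_atMost[OF n, of ?v'] by (simp only: Suc_1)
    finally have t: "t ^ fdes n (signing p S) =
        (\<Prod>i\<in>{1..n}. ?u i) * (\<Prod>i\<in>{1..n}. ?v' i)" .
    show ?thesis
      unfolding y t prod.distrib[symmetric] by (auto intro!: prod.cong)
  qed
  then have "(\<Sum>s\<in>signings n p. y ^ neg n s * t ^ fdes n s) =
      (\<Sum>S\<in>Pow {1..n}. \<Prod>i\<in>{1..n}. if i \<in> S then ?f i else ?g i)"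
    by (simp flip: sum.reindex_bij_betw[OF bij_betw_signing[OF p]])
  then show ?thesis by (simp only: prod_add_Pow finite_atLeastAtMost)
qed

section \<open>Statistics of the reverse complement\<close>

lemma card_reflect:
  assumes "\<And>i. i \<in> {1..n} \<Longrightarrow> n + 1 - i \<in> A \<longleftrightarrow> i \<in> B" "A \<subseteq> {1..n}" "B \<subseteq> {1..n}"
  shows "card A = card (B :: nat set)"
proof -
  have "bij_betw (\<lambda>i. n + 1 - i) B A"
  proof (rule bij_betw_byWitness[where f' = "\<lambda>i. n + 1 - i"])
    show "(\<lambda>i. n + 1 - i) ` A \<subseteq> B"
    proof safe
      fix j assume j: "j \<in> A"
      with assms(2) have "j \<in> {1..n}" by blast
      then have "n + 1 - j \<in> {1..n}" "n + 1 - (n + 1 - j) = j" by auto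
      then show "n + 1 - j \<in> B" using assms(1)[of "n + 1 - j"] j by simp
    qed
  qed (use assms in \<open>auto simp: subset_iff\<close>)
  then show ?thesis by (simp add: bij_betw_same_card)
qed

lemma rev_compl_less_iff:
  assumes p: "p \<in> perms n" and "i \<in> {1..n}" "j \<in> {1..n}"
  shows "rev_compl n p i < rev_compl n p j \<longleftrightarrow> p (n + 1 - j) < p (n + 1 - i)"
proof -
  have "n + 1 - i \<in> {1..n}" "n + 1 - j \<in> {1..n}" using assms by auto
  then have "p (n + 1 - i) \<in> {1..n}" "p (n + 1 - j) \<in> {1..n}"
    using perms_in_interval[OF p] by blast+
  moreover have "n + 1 - a < n + 1 - b \<longleftrightarrow> b < a" if "a \<in> {1..n}" "b \<in> {1..n}" for a b
    using that by auto
  ultimately show ?thesis using assms by (simp only: rev_compl_def if_True)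
qed

text \<open>Reversal and complement each flip the comparison, so descents remain descents; the pair
  at \<open>i\<close> comes from positions \<open>n - i\<close> and
  \<open>n + 1 - i\<close>.\<close>

lemma descent_rev_compl:
  assumes p: "p \<in> perms n" and "1 \<le> i" "i < n"
  shows "rev_compl n p i > rev_compl n p (i + 1) \<longleftrightarrow> descent n p (n - i)"
    and "rev_compl n p i < rev_compl n p (i + 1) \<longleftrightarrow> \<not> descent n p (n - i)"
proof -
  show "rev_compl n p i > rev_compl n p (i + 1) \<longleftrightarrow> descent n p (n - i)"
    using assms unfolding descent_def
    by (subst rev_compl_less_iff[OF p]) (auto simp: Suc_diff_le)
  show "rev_compl n p i < rev_compl n p (i + 1) \<longleftrightarrow> \<not> descent n p (n - i)"
    using assms perms_less_iff_not_descent[OF p, of "n - i"]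
    by (subst rev_compl_less_iff[OF p]) (auto simp: Suc_diff_le)
qed

text \<open>The shift to \<open>i - 1\<close> lets all three statistics be counted over
  \<open>{2..n}\<close>, the range of the telescoping product.\<close>

lemma des_rev_compl:
  assumes p: "p \<in> perms n"
  shows "des n (rev_compl n p) = card {i \<in> {2..n}. descent n p (i - 1)}"
  unfolding des_def
proof (rule card_reflect[where n = n])
  fix i assume "i \<in> {1..n}"
  then show "n + 1 - i \<in> {i \<in> {1..n - 1}. rev_compl n p (i + 1) < rev_compl n p i}
      \<longleftrightarrow> i \<in> {i \<in> {2..n}. descent n p (i - 1)}"
    using descent_rev_compl(1)[OF p, of "n + 1 - i"] by (cases "i = 1") auto
qed auto

lemma val_rev_compl:
  assumes p: "p \<in> perms n"
  shows "val n (rev_compl n p) = card {i \<in> {2..n}. \<not> descent n p (i - 1) \<and> descent n p i}"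
  unfolding val_def
proof (rule card_reflect[where n = n])
  fix i assume i: "i \<in> {1..n}"
  show "n + 1 - i \<in> {i \<in> {2..n - 1}. rev_compl n p i < rev_compl n p (i - 1)
        \<and> rev_compl n p i < rev_compl n p (i + 1)}
      \<longleftrightarrow> i \<in> {i \<in> {2..n}. \<not> descent n p (i - 1) \<and> descent n p i}"
  \<comment> \<open>At both ends the two sides fail, at \<open>i = n\<close> on the right because
    \<open>descent n p n\<close> is false.\<close>
  proof (cases "i = 1 \<or> i = n")
    case True
    then show ?thesis by (auto simp: descent_def)
  next
    case False
    then have "1 \<le> n - i" "n - i < n" "1 \<le> n + 1 - i" "n + 1 - i < n" using i by auto
    then show ?thesis
      using i descent_rev_compl(2)[OF p, of "n - i"] descent_rev_compl(1)[OF p, of "n - i"]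
        descent_rev_compl(2)[OF p, of "n + 1 - i"]
      by (auto simp: Suc_diff_le)
  qed
qed auto

text \<open>A valley of \<open>p\<close> reflects to a peak. The index \<open>i = n\<close> accounts
  for the left peak at 1: there \<open>descent n p n\<close> is false, and a descent at
  \<open>n - 1\<close> suffices.\<close>

lemma lpk_rev_compl:
  assumes p: "p \<in> perms n"
  shows "lpk n (rev_compl n p) = card {i \<in> {2..n}. descent n p (i - 1) \<and> \<not> descent n p i}"
  unfolding lpk_def
proof (rule card_reflect[where n = n])
  fix i assume i: "i \<in> {1..n}"
  show "n + 1 - i \<in> {i \<in> {1..n - 1}.
        2 \<le> i \<and> rev_compl n p (i - 1) < rev_compl n p i \<and> rev_compl n p (i + 1) < rev_compl n p i
        \<or> i = 1 \<and> rev_compl n p 2 < rev_compl n p 1}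
      \<longleftrightarrow> i \<in> {i \<in> {2..n}. descent n p (i - 1) \<and> \<not> descent n p i}"
  proof -
    consider "i = 1" | "i = n" "i \<noteq> 1" | "i \<noteq> 1" "i < n" using i by force
    then show ?thesis
    proof cases
      case 1
      then show ?thesis by auto
    next
      case 2
      then show ?thesis
        using descent_rev_compl(1)[OF p, of 1] by (auto simp: numeral_2_eq_2 descent_def)
    next
      case 3
      then show ?thesis
        using i descent_rev_compl(2)[OF p, of "n - i"] descent_rev_compl(1)[OF p, of "n + 1 - i"]
        by (auto simp: Suc_diff_le)
    qed
  qed
qed auto

section \<open>Separating the permutations in the sums\<close>

lemma inj_on_rev_compl: "inj_on (rev_compl n) (perms n)"
proof (rule inj_onI)
  fix p q assume p: "p \<in> perms n" and q: "q \<in> perms n" and eq: "rev_compl n p = rev_compl n q"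
  show "p = q"
  proof
    fix i
    show "p i = q i"
    proof (cases "i \<in> {1..n}")
      case True
      then have "p i \<in> {1..n}" "q i \<in> {1..n}" using perms_in_interval p q by blast+
      \<comment> \<open>Evaluating at the reflected position gives \<open>n + 1 - p i\<close>, which
        determines \<open>p i\<close> because \<open>p i \<le> n\<close>.\<close>
      then show ?thesis
        using True fun_cong[OF eq, of "n + 1 - i"] by (auto simp: rev_compl_def split: if_splits)
    next
      case False
      then show ?thesis using p q by (simp add: perms_def permutes_not_in)
    qed
  qed
qed

text \<open>Forgetting the signs of a signing recovers the underlying permutation.\<close>

lemma signings_disjoint:
  assumes p: "p \<in> perms n" and q: "q \<in> perms n" and "p \<noteq> q"
  shows "signings n p \<inter> signings n q = {}"
proof (rule ccontr)
  assume "signings n p \<inter> signings n q \<noteq> {}"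
  then obtain s where s: "s \<in> signings n p" "s \<in> signings n q" by blast
  have "p i = q i" for i
  proof (cases "i \<in> {1..n}")
    case True
    then have "\<bar>s (int i)\<bar> = int (p i)" "\<bar>s (int i)\<bar> = int (q i)"
      using s by (auto simp: signings_def)
    then show ?thesis by simp
  next
    case False
    then show ?thesis using p q by (simp add: perms_def permutes_not_in)
  qed
  with \<open>p \<noteq> q\<close> show False by blast
qed

lemma finite_perms: "finite (perms n)"
  by (simp add: perms_def finite_permutations)

lemma finite_signings: "p \<in> perms n \<Longrightarrow> finite (signings n p)"
  using bij_betw_finite[OF bij_betw_signing] by simp

lemma neg_fdes_gf_eq_sum:
  assumes "P \<subseteq> perms n"
  shows "neg_fdes_gf n P y t = (\<Sum>p\<in>P. \<Sum>s\<in>signings n p. y ^ neg n s * t ^ fdes n s)"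
  unfolding neg_fdes_gf_def signings_set_def
proof (rule sum.UNION_disjoint)
  show "finite P" using assms finite_perms finite_subset by blast
  show "\<forall>p\<in>P. finite (signings n p)" using assms finite_signings by blast
  show "\<forall>p\<in>P. \<forall>q\<in>P. p \<noteq> q \<longrightarrow> signings n p \<inter> signings n q = {}"
    using assms signings_disjoint by (simp add: subset_iff)
qed

section \<open>The telescoping product\<close>

text \<open>Stated for any word \<open>d\<close>, with \<open>d n\<close> free, so that the
  induction can extend the word by either letter. The leading factor is the boundary term of the
  telescoping; for \<open>n = 1\<close> it is the whole product.\<close>

lemma descent_word_prod:
  fixes y t :: "'a::field" and d :: "nat \<Rightarrow> bool"
  assumes nz: "1 + y * t\<^sup>2 \<noteq> 0" "y + t\<^sup>2 \<noteq> 0" "1 + y * t \<noteq> 0" "y + t \<noteq> 0"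
  defines "Y \<equiv> t * (1 + y) * (y + t) / ((y + t\<^sup>2) * (1 + y * t))"
    and "Z \<equiv> t * (1 + y) * (1 + y * t) / ((1 + y * t\<^sup>2) * (y + t))"
    and "T \<equiv> (y + t\<^sup>2) / (1 + y * t\<^sup>2)"
  assumes "n \<ge> 1"
  shows "(\<Prod>i\<in>{1..n}. y * (if i = 1 then t else if d (i - 1) then 1 else t\<^sup>2)
                 + (if d i then t\<^sup>2 else 1)) =
    (if d n then t * (y + t) else 1 + y * t) * (1 + y * t\<^sup>2) ^ (n - 1) *
    (\<Prod>i\<in>{2..n}. (if d (i - 1) \<and> \<not> d i then Y else 1) *
       (if \<not> d (i - 1) \<and> d i then Z else 1) * (if d (i - 1) then T else 1))"
  using \<open>n \<ge> 1\<close>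
proof (induction n rule: dec_induct)
  case base
  then show ?case by (simp add: algebra_simps power2_eq_square)
next
  case (step m)
  \<comment> \<open>The coboundary: it makes up for the difference between the factor at a position and the
    weight \<open>1 + y * t\<^sup>2\<close> times \<open>Y\<close>, \<open>Z\<close>, \<open>T\<close>.\<close>
  define h where "h b = (if b then t * (y + t) else 1 + y * t)" for b
  have "h (d m) * (y * (if d m then 1 else t\<^sup>2) + (if d (Suc m) then t\<^sup>2 else 1)) =
      h (d (Suc m)) * (1 + y * t\<^sup>2) * ((if d m \<and> \<not> d (Suc m) then Y else 1) *
       (if \<not> d m \<and> d (Suc m) then Z else 1) * (if d m then T else 1))"
    \<comment> \<open>For equal letters \<open>h\<close> cancels. At a change, the two values of
      \<open>h\<close> absorb the factors \<open>1 + y * t\<close> and \<open>y + t\<close> of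
      \<open>Y\<close> or \<open>Z\<close>, and \<open>T\<close> removes
      \<open>y + t\<^sup>2\<close> from \<open>Y\<close>.\<close>
    using nz unfolding h_def Y_def Z_def T_def
    by (cases "d m"; cases "d (Suc m)")
      (simp_all add: divide_simps, simp_all add: algebra_simps power2_eq_square)
  moreover have "(1 + y * t\<^sup>2) ^ m = (1 + y * t\<^sup>2) ^ (m - 1) * (1 + y * t\<^sup>2)"
    using step.hyps by (cases m) auto
  ultimately show ?case
    using step by (simp add: h_def[symmetric] mult.assoc mult.left_commute)
qed

text \<open>As polynomials in \<open>t\<close> with coefficients in \<rat>[y] these have visibly
  nonzero coefficients, and \<open>to_fract\<close> is injective.\<close>

lemma denominators_neq_0:
  "1 + var_y * var_t\<^sup>2 \<noteq> 0" "var_y + var_t\<^sup>2 \<noteq> 0"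
  "1 + var_y * var_t \<noteq> 0" "var_y + var_t \<noteq> 0"
  unfolding var_y_def var_t_def
  by (simp_all add: power2_eq_square one_pCons flip: to_fract_1 to_fract_add to_fract_mult)

theorem theorem5p15:
  fixes n :: nat and P :: "(nat \<Rightarrow> nat) set" and y t :: ratfun2
  assumes "n \<ge> 1" and "P \<subseteq> perms n"
  defines "y \<equiv> var_y" and "t \<equiv> var_t"
  shows "neg_fdes_gf n P y t =
    (1 + y * t) * (1 + y * t ^ 2) ^ (n - 1) *
    lpk_val_des_gf n (rev_compl n ` P)
      (t * (1 + y) * (y + t) / ((y + t ^ 2) * (1 + y * t)))
      (t * (1 + y) * (1 + y * t) / ((1 + y * t ^ 2) * (y + t)))
      ((y + t ^ 2) / (1 + y * t ^ 2))"
proof -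
  let ?Y = "t * (1 + y) * (y + t) / ((y + t ^ 2) * (1 + y * t))"
  let ?Z = "t * (1 + y) * (1 + y * t) / ((1 + y * t ^ 2) * (y + t))"
  let ?T = "(y + t ^ 2) / (1 + y * t ^ 2)"
  have "(\<Sum>s\<in>signings n p. y ^ neg n s * t ^ fdes n s) =
      (1 + y * t) * (1 + y * t ^ 2) ^ (n - 1) *
      (?Y ^ lpk n (rev_compl n p) * ?Z ^ val n (rev_compl n p) * ?T ^ des n (rev_compl n p))"
    if "p \<in> P" for p
  proof -
    have p: "p \<in> perms n" using that assms by blast
    \<comment> \<open>The descent word ends in an ascent, which selects \<open>1 + y * t\<close> as
      the boundary factor.\<close>
    have "\<not> descent n p n" by (simp add: descent_def)
    then show ?thesis
      unfolding signings_gf_eq_prod[OF p \<open>n \<ge> 1\<close>] lpk_rev_compl[OF p] val_rev_compl[OF p]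
        des_rev_compl[OF p] power_card_filter[OF finite_atLeastAtMost] prod.distrib[symmetric]
      using descent_word_prod[OF denominators_neq_0[folded y_def t_def] \<open>n \<ge> 1\<close>,
          of "descent n p"]
      by (simp only: if_False)
  qed
  moreover have "inj_on (rev_compl n) P"
    using inj_on_rev_compl \<open>P \<subseteq> perms n\<close> by (rule inj_on_subset)
  ultimately show ?thesis
    unfolding neg_fdes_gf_eq_sum[OF \<open>P \<subseteq> perms n\<close>] lpk_val_des_gf_def
    by (simp add: sum.reindex sum_distrib_left)
qed

end
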